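(* Let $m,n,s$ be positive integers, let $\mathcal{X}=\{1,\ldots,m\}\times\{1,\ldots,n\}$, and let $\alpha,\beta$ be real numbers such that $\alpha i_1^s+\beta j_1^s\neq\alpha i_2^s+\beta j_2^s$ for all $(i_1,j_1),(i_2,j_2)\in\mathcal{X}$ with $(i_1,j_1)\neq(i_2,j_2)$. Let $t_1,t_2,\ldots,t_{mn}$ be the numbers $\alpha i^s+\beta j^s$, $(i,j)\in\mathcal{X}$, listed in row-by-row order, i.e. $t_{(i-1)n+j}=\alpha i^s+\beta j^s$ (so the list is $\alpha+\beta,\ \alpha+\beta 2^s,\ldots,\alpha+\beta n^s,\ \alpha 2^s+\beta,\ldots,\alpha m^s+\beta n^s$). Then for every matrix $(a_{ij})\in\mathbb{R}^{m\times n}$ there exists a unique polynomial $p\in{}_{\alpha}^{\beta}\Pi_{s(mn-1)}^{2}$ such that $p(i,j)=a_{ij}$ for all $(i,j)\in\mathcal{X}$, and it is given by $$p(x,y)=\sum_{k=1}^{mn}F[\widetilde a_{t_1},\widetilde a_{t_2},\ldots,\widetilde a_{t_k}]\prod_{l=1}^{k-1}\big((\alpha x^s+\beta y^s)-t_l\big),$$ where $\widetilde a_{\alpha i^s+\beta j^s}=a_{ij}$ for $(i,j)\in\mathcal{X}$ and $F[\cdot]$ denotes Newton divided differences, defined recursively by $F[\widetilde a_{t_l}]=\widetilde a_{t_l}$ for $1\le l\le mn$ and $$F[\widetilde a_{t_l},\ldots,\widetilde a_{t_{r}}]=\frac{F[\widetilde a_{t_{l+1}},\ldots,\widetilde a_{t_{r}}]-F[\widetilde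 a_{t_l},\ldots,\widetilde a_{t_{r-1}}]}{t_r-t_l}\quad\text{for }1\le l<r\le mn.$$
   Context: For real scalars $\alpha,\beta$ and a positive integer $s$, ${}_{\alpha}^{\beta}\Pi_{s(mn-1)}^{2}$ denotes the space of all bivariate real polynomials of the form $p(x,y)=\sum_{k=0}^{mn-1}\lambda_k(\alpha x^s+\beta y^s)^k$ with $\lambda_k\in\mathbb{R}$ for $0\le k\le mn-1$. An empty product equals $1$. *)

theory Defs
  imports "HOL-Computational_Algebra.Polynomial"
begin

(* Bivariate real polynomials are elements of R[x][y], i.e. real poly poly: the outer
   variable is y, the coefficients are polynomials in x. *)

definition varx :: "real poly poly" where
  "varx = [:[:0, 1:]:]"

definition vary :: "real poly poly" where
  "vary = [:0, 1:]"

definition const2 :: "real \<Rightarrow> real poly poly" where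
  "const2 c = [:[:c:]:]"

definition eval2 :: "real poly poly \<Rightarrow> real \<Rightarrow> real \<Rightarrow> real" where
  "eval2 p x y = poly (poly p [:y:]) x"

lemma eval2_varx: "eval2 varx x y = x"
  and eval2_vary: "eval2 vary x y = y"
  and eval2_const2: "eval2 (const2 c) x y = c"
  by (simp_all add: eval2_def varx_def vary_def const2_def)

definition ridge :: "real \<Rightarrow> real \<Rightarrow> nat \<Rightarrow> real poly poly" where
  "ridge \<alpha> \<beta> s = const2 \<alpha> * varx ^ s + const2 \<beta> * vary ^ s"

(* N bounds the powers of alpha x^s + beta y^s, so the bound on the total degree is s * N. *)
definition ridge_space :: "real \<Rightarrow> real \<Rightarrow> nat \<Rightarrow> nat \<Rightarrow> real poly poly set" where
  "ridge_space \<alpha> \<beta> s N =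
     {p. \<exists>c :: nat \<Rightarrow> real. p = (\<Sum>k = 0..N. const2 (c k) * ridge \<alpha> \<beta> s ^ k)}"

(* Row-by-row enumeration, indexed from 1; node_row_by_row is the intended characterization. *)
definition node :: "real \<Rightarrow> real \<Rightarrow> nat \<Rightarrow> nat \<Rightarrow> nat \<Rightarrow> real" where
  "node \<alpha> \<beta> s n k =
     \<alpha> * real ((k - 1) div n + 1) ^ s + \<beta> * real ((k - 1) mod n + 1) ^ s"

lemma node_row_by_row:
  assumes "i \<ge> 1" "j \<in> {1..n}"
  shows "node \<alpha> \<beta> s n ((i - 1) * n + j) = \<alpha> * real i ^ s + \<beta> * real j ^ s"
proof -
  obtain i' where i: "i = Suc i'" using assms(1) by (cases i) auto
  obtain j' where j: "j = Suc j'" using assms(2) by (cases j) auto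
  have "j' < n" using assms(2) j by simp
  then show ?thesis by (simp add: node_def i j)
qed

(* The data as a function of the node value. Only meaningful at node values, and only when
   these are pairwise distinct; see node_data_eq. *)
definition node_data ::
  "real \<Rightarrow> real \<Rightarrow> nat \<Rightarrow> nat \<Rightarrow> nat \<Rightarrow> (nat \<Rightarrow> nat \<Rightarrow> real) \<Rightarrow> real \<Rightarrow> real" where
  "node_data \<alpha> \<beta> s m n a u =
     (case the_inv_into ({1..m} \<times> {1..n}) (\<lambda>(i, j). \<alpha> * real i ^ s + \<beta> * real j ^ s) u
      of (i, j) \<Rightarrow> a i j)"

lemma node_data_eq:
  assumes "inj_on (\<lambda>(i, j). \<alpha> * real i ^ s + \<beta> * real j ^ s) ({1..m} \<times> {1..n})"
    and "i \<in> {1..m}" "j \<in> {1..n}"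
  shows "node_data \<alpha> \<beta> s m n a (\<alpha> * real i ^ s + \<beta> * real j ^ s) = a i j"
  using the_inv_into_f_f[OF assms(1), of "(i, j)"] assms(2,3) by (simp add: node_data_def)

(* divided_difference f t l r is F[f(t_l), ..., f(t_r)]; the value for r < l is irrelevant. *)
function divided_difference ::
  "(real \<Rightarrow> real) \<Rightarrow> (nat \<Rightarrow> real) \<Rightarrow> nat \<Rightarrow> nat \<Rightarrow> real" where
  "divided_difference f t l r =
     (if r \<le> l then f (t l)
      else (divided_difference f t (l + 1) r - divided_difference f t l (r - 1)) / (t r - t l))"
  by auto
termination by (relation "measure (\<lambda>(f, t, l, r). r - l)") auto

declare divided_difference.simps [simp del]

end

(* Substituting the ridge function g = alpha x^s + beta y^s for the variable identifies univariate
   polynomials with ridge polynomials and turns evaluation at (i, j) into evaluation at a node.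
   The theorem is thus univariate Newton interpolation at mn distinct nodes: the Newton polynomials
   satisfy the Neville recursion, because both sides of it agree at the first d nodes and have the
   same coefficient of degree d, which is the divided difference. *)
theory Submission
  imports Defs "HOL-Library.FuncSet"
begin

section \<open>Univariate Newton interpolation on windows of consecutive nodes\<close>

definition newton_basis :: "(nat \<Rightarrow> real) \<Rightarrow> nat \<Rightarrow> nat \<Rightarrow> real poly" where
  "newton_basis t l k = (\<Prod>i<k. [:- t (l + i), 1:])"

text \<open>Here \<open>d\<close> bounds the degree, so the window consists of the
  \<open>d + 1\<close> nodes \<open>t l\<close>, ..., \<open>t (l + d)\<close>. The left end
  \<open>l\<close> stays variable because the recursion below compares the windows starting at
  \<open>l\<close> and at \<open>Suc l\<close>.\<close>

definition newton :: "(real \<Rightarrow> real) \<Rightarrow> (nat \<Rightarrow> real) \<Rightarrow> nat \<Rightarrow> nat \<Rightarrow> real poly" where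
  "newton f t l d = (\<Sum>k\<le>d. smult (divided_difference f t l (l + k)) (newton_basis t l k))"

lemma degree_newton_basis: "degree (newton_basis t l k) = k"
  unfolding newton_basis_def by (subst degree_prod_sum_eq) auto

lemma coeff_newton_basis: "coeff (newton_basis t l k) k = 1"
  using lead_coeff_prod[of "\<lambda>i. [:- t (l + i), 1:]" "{..<k}"] degree_newton_basis[of t l k]
  unfolding newton_basis_def by simp

lemma poly_newton_basis_eq_0: "i < k \<Longrightarrow> poly (newton_basis t l k) (t (l + i)) = 0"
  by (auto simp: newton_basis_def poly_prod)

lemma newton_Suc:
  "newton f t l (Suc d) =
     newton f t l d + smult (divided_difference f t l (l + Suc d)) (newton_basis t l (Suc d))"
  by (simp add: newton_def)

lemma degree_newton_le: "degree (newton f t l d) \<le> d"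
  unfolding newton_def
  by (intro degree_sum_le) (auto intro: order.trans[OF degree_smult_le] simp: degree_newton_basis)

text \<open>Only the last summand reaches degree \<open>d\<close>, and its basis polynomial is
  monic. Through this fact the recursion of divided differences becomes a statement about
  polynomials.\<close>

lemma coeff_newton: "coeff (newton f t l d) d = divided_difference f t l (l + d)"
proof (cases d)
  case 0
  then show ?thesis by (simp add: newton_def newton_basis_def)
next
  case (Suc e)
  have "coeff (newton f t l e) (Suc e) = 0"
    using degree_newton_le[of f t l e] by (intro coeff_eq_0) simp
  then show ?thesis
    unfolding Suc newton_Suc using coeff_newton_basis[of t l "Suc e"] by simp
qed

text \<open>Two polynomials of degree at most \<open>d + 1\<close> coincide if they agree at
  \<open>d + 1\<close> points and in the coefficient of degree \<open>d + 1\<close>. The last node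
  \<open>t (l + Suc d)\<close> is left out of the comparison on purpose: the value of the left side
  there is what the recursion will later supply.\<close>

lemma neville_recursion:
  assumes inj: "inj_on t {l..l + Suc d}"
    and left: "\<And>i. i \<le> d \<Longrightarrow> poly (newton f t l d) (t (l + i)) = f (t (l + i))"
    and right: "\<And>i. i \<le> d \<Longrightarrow> poly (newton f t (Suc l) d) (t (Suc l + i)) = f (t (Suc l + i))"
  shows "newton f t l (Suc d) =
    smult (1 / (t (l + Suc d) - t l))
      ([:- t l, 1:] * newton f t (Suc l) d - [:- t (l + Suc d), 1:] * newton f t l d)"
    (is "_ = smult ?c (?A * ?Q - ?B * ?P)")
proof (rule poly_eqI_degree_lead_coeff)
  have neq: "t (l + Suc d) \<noteq> t l"
    using inj_onD[OF inj, of "l + Suc d" l] by auto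
  \<comment> \<open>Hence multiplication by the monic linear factors \<open>?A\<close> and
    \<open>?B\<close> moves the coefficients of degree \<open>d\<close> up to degree
    \<open>d + 1\<close>, where their difference is the numerator of the divided difference.\<close>
  have "coeff ?Q (Suc d) = 0" "coeff ?P (Suc d) = 0"
    using degree_newton_le[of f t "Suc l" d] degree_newton_le[of f t l d]
    by (auto intro: coeff_eq_0)
  then show "coeff (newton f t l (Suc d)) (Suc d) = coeff (smult ?c (?A * ?Q - ?B * ?P)) (Suc d)"
    by (simp add: coeff_newton divided_difference.simps[of f t l "Suc (l + d)"])
  show "degree (newton f t l (Suc d)) \<le> Suc d"
    by (rule degree_newton_le)
  have "degree (?A * ?Q) \<le> Suc d" "degree (?B * ?P) \<le> Suc d"
    using degree_mult_le[of ?A ?Q] degree_mult_le[of ?B ?P]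
      degree_newton_le[of f t "Suc l" d] degree_newton_le[of f t l d] by simp_all
  then show "degree (smult ?c (?A * ?Q - ?B * ?P)) \<le> Suc d"
    by (intro order.trans[OF degree_smult_le] degree_diff_le)
  have "inj_on t {l..l + d}"
    using inj by (rule inj_on_subset) auto
  then show "Suc d \<le> card (t ` {l..l + d})"
    by (simp add: card_image)
  fix z assume "z \<in> t ` {l..l + d}"
  then obtain i where i: "i \<le> d" and z: "z = t (l + i)"
    by (auto simp: image_iff) (metis le_add_diff_inverse nat_add_left_cancel_le)
  have "poly (newton f t l (Suc d)) z = f z"
    using left[OF i] poly_newton_basis_eq_0[of i "Suc d" t l] i by (simp add: newton_Suc z)
  \<comment> \<open>The first node lies outside the window of \<open>?Q\<close>, but there the
    factor \<open>?A\<close> vanishes; any other node has index \<open>i - 1\<close> in that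
    window.\<close>
  moreover have "poly (?A * ?Q) z = (z - t l) * f z"
  proof (cases i)
    case (Suc i')
    then show ?thesis using right[of i'] i by (simp add: z algebra_simps)
  qed (simp add: z)
  moreover have "poly (?B * ?P) z = (z - t (l + Suc d)) * f z"
    using left[OF i] by (simp add: z algebra_simps)
  ultimately show "poly (newton f t l (Suc d)) z = poly (smult ?c (?A * ?Q - ?B * ?P)) z"
    using neq by (simp add: divide_simps) (simp add: algebra_simps)
qed

text \<open>Induction on \<open>d\<close> for all windows at once: passing to \<open>Suc d\<close>
  adds a multiple of a basis polynomial that vanishes at all earlier nodes, so only the newest node
  requires an argument.\<close>

lemma poly_newton:
  assumes "inj_on t {l..l + d}" "i \<le> d"
  shows "poly (newton f t l d) (t (l + i)) = f (t (l + i))"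
  using assms
proof (induction d arbitrary: l i)
  case 0
  then show ?case by (simp add: newton_def newton_basis_def divided_difference.simps)
next
  case (Suc d)
  have "inj_on t {l..l + d}" "inj_on t {Suc l..Suc l + d}"
    using Suc.prems(1) by (auto elim: inj_on_subset)
  note left = Suc.IH[OF this(1)] and right = Suc.IH[OF this(2)]
  show ?case
  proof (cases "i \<le> d")
    case True
    then show ?thesis
      using left[of i] poly_newton_basis_eq_0[of i "Suc d" t l] by (simp add: newton_Suc)
  next
    case False
    then have i: "i = Suc d" using Suc.prems(2) by simp
    \<comment> \<open>At the newest node the left window's term in the recursion vanishes, and the
      quotient in front of the right window's polynomial equals 1.\<close>
    have "t (l + Suc d) \<noteq> t l"
      using inj_onD[OF Suc.prems(1), of "l + Suc d" l] by auto
    then show ?thesis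
      using right[of d] neville_recursion[OF Suc.prems(1) left right]
      by (simp add: i field_simps)
  qed
qed

section \<open>Substitution of a bivariate polynomial into univariate ones\<close>

lemma const2_0 [simp]: "const2 0 = 0"
  and const2_1: "const2 1 = 1"
  and const2_add: "const2 (b + c) = const2 b + const2 c"
  and const2_uminus: "const2 (- c) = - const2 c"
  and const2_mult: "const2 (b * c) = const2 b * const2 c"
  by (simp_all add: const2_def one_pCons)

text \<open>The composition q(g). Embedding the real coefficients as constants first places them in
  the ring containing \<open>g\<close>, so that composition becomes evaluation at \<open>g\<close>;
  the lemmas below show that it respects the ring operations.\<close>

definition lift2 :: "real poly poly \<Rightarrow> real poly \<Rightarrow> real poly poly" where
  "lift2 g q = poly (map_poly const2 q) g"

lemma lift2_0 [simp]: "lift2 g 0 = 0"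
  and lift2_pCons [simp]: "lift2 g (pCons c q) = const2 c + g * lift2 g q"
  by (simp_all add: lift2_def map_poly_pCons)

lemma lift2_add: "lift2 g (p + q) = lift2 g p + lift2 g q"
  by (induction p q rule: poly_induct2) (simp_all add: const2_add algebra_simps)

lemma lift2_smult: "lift2 g (smult c q) = const2 c * lift2 g q"
  by (induction q rule: pCons_induct) (simp_all add: const2_mult algebra_simps)

lemma lift2_mult: "lift2 g (p * q) = lift2 g p * lift2 g q"
  by (induction p rule: pCons_induct) (simp_all add: lift2_add lift2_smult algebra_simps)

lemma lift2_sum: "lift2 g (sum h A) = (\<Sum>k\<in>A. lift2 g (h k))"
  by (induction A rule: infinite_finite_induct) (simp_all add: lift2_add)

lemma lift2_prod: "lift2 g (prod h A) = (\<Prod>k\<in>A. lift2 g (h k))"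
  by (induction A rule: infinite_finite_induct) (simp_all add: lift2_mult one_pCons const2_1)

lemma lift2_monom: "lift2 g (monom c k) = const2 c * g ^ k"
  by (induction k) (simp_all add: monom_0 monom_Suc algebra_simps)

text \<open>Turns the univariate Newton form into the formula of the theorem; the degree index,
  counted from 0, is shifted to the term index, counted from 1.\<close>

lemma lift2_newton:
  "lift2 g (newton f t (Suc 0) d) =
     (\<Sum>k = 1..Suc d. const2 (divided_difference f t 1 k) * (\<Prod>l = 1..k - 1. g - const2 (t l)))"
proof -
  have "lift2 g [:- c, 1:] = g - const2 c" for c
    by (simp add: const2_uminus const2_1)
  then show ?thesis
    unfolding One_nat_def sum.atLeast1_atMost_eq prod.atLeast1_atMost_eq
    by (simp add: newton_def newton_basis_def lift2_sum lift2_smult lift2_prod lessThan_Suc_atMost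
        del: lift2_pCons)
qed

lemma eval2_lift2: "eval2 (lift2 g q) x y = poly q (eval2 g x y)"
  by (induction q rule: pCons_induct) (simp_all add: eval2_def const2_def)

lemma eval2_ridge: "eval2 (ridge \<alpha> \<beta> s) x y = \<alpha> * x ^ s + \<beta> * y ^ s"
  by (simp add: eval2_def ridge_def const2_def varx_def vary_def)

text \<open>The scalars of a ridge polynomial are the coefficients of q. Since p is determined by q,
  uniqueness of q among polynomials of bounded degree yields uniqueness of p.\<close>

lemma ridge_space_eq: "ridge_space \<alpha> \<beta> s N = lift2 (ridge \<alpha> \<beta> s) ` {q. degree q \<le> N}"
proof (intro set_eqI iffI)
  fix p assume "p \<in> ridge_space \<alpha> \<beta> s N"
  then obtain c where "p = (\<Sum>k = 0..N. const2 (c k) * ridge \<alpha> \<beta> s ^ k)"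
    by (auto simp: ridge_space_def)
  then have "p = lift2 (ridge \<alpha> \<beta> s) (\<Sum>k = 0..N. monom (c k) k)"
    by (simp add: lift2_sum lift2_monom)
  moreover have "degree (\<Sum>k = 0..N. monom (c k) k) \<le> N"
    by (intro degree_sum_le) (auto intro: order.trans[OF degree_monom_le])
  ultimately show "p \<in> lift2 (ridge \<alpha> \<beta> s) ` {q. degree q \<le> N}"
    by blast
next
  fix p assume "p \<in> lift2 (ridge \<alpha> \<beta> s) ` {q. degree q \<le> N}"
  then obtain q where "degree q \<le> N" and p: "p = lift2 (ridge \<alpha> \<beta> s) q"
    by blast
  then have "q = (\<Sum>k = 0..N. monom (coeff q k) k)"
    using poly_as_sum_of_monoms'[of q N] by (simp add: atMost_atLeast0)
  then have "p = (\<Sum>k = 0..N. const2 (coeff q k) * ridge \<alpha> \<beta> s ^ k)"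
    unfolding p by (metis (no_types, lifting) lift2_monom lift2_sum sum.cong)
  then show "p \<in> ridge_space \<alpha> \<beta> s N"
    by (auto simp: ridge_space_def)
qed

section \<open>Row-by-row numbering of the grid, and the interpolation theorem\<close>

lemma bij_betw_row_by_row:
  assumes "n \<ge> 1"
  shows "bij_betw (\<lambda>k. ((k - 1) div n + 1, (k - 1) mod n + 1)) {1..m * n} ({1..m} \<times> {1..n :: nat})"
proof (rule bij_betwI[where g = "\<lambda>(i, j). (i - 1) * n + j"])
  show "(\<lambda>k. ((k - 1) div n + 1, (k - 1) mod n + 1)) \<in> {1..m * n} \<rightarrow> {1..m} \<times> {1..n}"
    using assms by (auto simp: Suc_le_eq less_mult_imp_div_less)
  show "(\<lambda>(i, j). (i - 1) * n + j) \<in> {1..m} \<times> {1..n} \<rightarrow> {1..m * n}"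
  proof (rule funcsetI)
    fix y assume "y \<in> {1..m} \<times> {1..n}"
    then obtain i j where y: "y = (Suc i, j)" and "i < m" "1 \<le> j" "j \<le> n"
      by (cases y) (auto simp: Suc_le_eq dest!: gr0_implies_Suc)
    \<comment> \<open>Row \<open>Suc i\<close> occupies the numbers from \<open>i * n + 1\<close> to
      \<open>Suc i * n\<close>.\<close>
    have "i * n + j \<le> Suc i * n" using \<open>j \<le> n\<close> by simp
    also have "\<dots> \<le> m * n" using \<open>i < m\<close> by (intro mult_le_mono1) simp
    finally show "(case y of (i, j) \<Rightarrow> (i - 1) * n + j) \<in> {1..m * n}"
      using \<open>1 \<le> j\<close> by (simp add: y)
  qed
  show "(case ((k - 1) div n + 1, (k - 1) mod n + 1) of (i, j) \<Rightarrow> (i - 1) * n + j) = k"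
    if "k \<in> {1..m * n}" for k
    using that div_mult_mod_eq[of "k - 1" n] by simp
  show "(\<lambda>k. ((k - 1) div n + 1, (k - 1) mod n + 1)) (case y of (i, j) \<Rightarrow> (i - 1) * n + j) = y"
    if "y \<in> {1..m} \<times> {1..n}" for y
  proof -
    from that obtain i j where "y = (Suc i, Suc j)" "j < n"
      by (cases y) (auto simp: Suc_le_eq dest!: gr0_implies_Suc)
    then show ?thesis by simp
  qed
qed

theorem corollary3p14:
  fixes m n s :: nat and \<alpha> \<beta> :: real and a :: "nat \<Rightarrow> nat \<Rightarrow> real"
  assumes "m \<ge> 1" and "n \<ge> 1" and "s \<ge> 1"
    and "\<And>i1 j1 i2 j2. (i1, j1) \<in> {1..m} \<times> {1..n} \<Longrightarrow> (i2, j2) \<in> {1..m} \<times> {1..n} \<Longrightarrow>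
           (i1, j1) \<noteq> (i2, j2) \<Longrightarrow>
           \<alpha> * real i1 ^ s + \<beta> * real j1 ^ s \<noteq> \<alpha> * real i2 ^ s + \<beta> * real j2 ^ s"
  shows "(\<exists>!p. p \<in> ridge_space \<alpha> \<beta> s (m * n - 1) \<and>
            (\<forall>(i, j) \<in> {1..m} \<times> {1..n}. eval2 p (real i) (real j) = a i j)) \<and>
         (\<forall>p. p \<in> ridge_space \<alpha> \<beta> s (m * n - 1) \<and>
            (\<forall>(i, j) \<in> {1..m} \<times> {1..n}. eval2 p (real i) (real j) = a i j) \<longrightarrow>
            p = (\<Sum>k = 1..m * n.
                  const2 (divided_difference (node_data \<alpha> \<beta> s m n a) (node \<alpha> \<beta> s n) 1 k) *
                  (\<Prod>l = 1..k - 1. ridge \<alpha> \<beta> s - const2 (node \<alpha> \<beta> s n l))))"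
proof -
  define N where "N = m * n - 1"
  have mn: "m * n = Suc N"
    using assms(1,2) by (simp add: N_def)
  define X where "X = {1..m} \<times> {1..n}"
  define g where "g = ridge \<alpha> \<beta> s"
  define u where "u = (\<lambda>(i, j). \<alpha> * real i ^ s + \<beta> * real j ^ s)"
  define t where "t = node \<alpha> \<beta> s n"
  define f where "f = node_data \<alpha> \<beta> s m n a"
  define q0 where "q0 = newton f t (Suc 0) N"
  have inj_u: "inj_on u X"
    using assms(4) unfolding inj_on_def u_def X_def by fast
  \<comment> \<open>Factoring the node sequence through the numbering of the grid reduces
    distinctness of the nodes to injectivity of \<open>u\<close> on \<open>X\<close>.\<close>
  have t_eq: "t = u \<circ> (\<lambda>k. ((k - 1) div n + 1, (k - 1) mod n + 1))"
    by (auto simp: t_def node_def u_def)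
  have bij_t: "bij_betw t {1..Suc N} (u ` X)"
    unfolding t_eq mn[symmetric] X_def
    using bij_betw_row_by_row[OF assms(2)] inj_u[unfolded X_def]
    by (intro bij_betw_trans) (auto simp: bij_betw_def)
  have card: "card (u ` X) = Suc N"
    using bij_betw_same_card[OF bij_t] by simp
  have f_u: "f (u (i, j)) = a i j" if "(i, j) \<in> X" for i j
    using node_data_eq[OF inj_u[unfolded u_def X_def], of i j] that
    by (simp add: f_def u_def X_def)
  have q0: "poly q0 z = f z" if z: "z \<in> u ` X" for z
  proof -
    have "z \<in> t ` {1..Suc N}"
      using bij_betw_imp_surj_on[OF bij_t] z by simp
    then obtain k where "k \<in> {1..Suc N}" "z = t k" by blast
    then show ?thesis
      using poly_newton[of t "Suc 0" N "k - 1" f] bij_betw_imp_inj_on[OF bij_t]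
      by (auto simp: q0_def)
  qed
  \<comment> \<open>The ridge polynomial takes the value \<open>u (i, j)\<close> at (i, j), so the
    bivariate conditions on \<open>lift2 g q\<close> are univariate conditions on q at the
    nodes.\<close>
  have interp: "(\<forall>(i, j) \<in> X. eval2 (lift2 g q) (real i) (real j) = a i j) \<longleftrightarrow>
      (\<forall>z \<in> u ` X. poly q z = f z)" for q
    using f_u by (auto simp: eval2_lift2 g_def eval2_ridge u_def)
  \<comment> \<open>Identifying every solution with \<open>lift2 g q0\<close> settles both
    uniqueness and the explicit formula.\<close>
  have unique: "p = lift2 g q0"
    if p: "p \<in> ridge_space \<alpha> \<beta> s N" "\<forall>(i, j) \<in> X. eval2 p (real i) (real j) = a i j" for p
  proof -
    obtain q where q: "degree q \<le> N" "p = lift2 g q"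
      using p(1) by (auto simp: ridge_space_eq g_def)
    have interpolates: "\<forall>z \<in> u ` X. poly q z = f z"
      using iffD1[OF interp p(2)[unfolded q(2)]] .
    have "q = q0"
    \<comment> \<open>Both polynomials have degree at most \<open>N\<close> and agree at
      \<open>Suc N\<close> distinct nodes.\<close>
    proof (rule poly_eqI_degree)
      show "poly q z = poly q0 z" if "z \<in> u ` X" for z
        using bspec[OF interpolates that] q0[OF that] by simp
    qed (use q(1) degree_newton_le[of f t "Suc 0" N] in \<open>simp_all add: card q0_def\<close>)
    then show ?thesis using q(2) by simp
  qed
  have "lift2 g q0 \<in> ridge_space \<alpha> \<beta> s N"
    unfolding ridge_space_eq g_def q0_def using degree_newton_le by blast
  moreover have "\<forall>(i, j) \<in> X. eval2 (lift2 g q0) (real i) (real j) = a i j"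
    using interp q0 by blast
  ultimately have "\<exists>!p. p \<in> ridge_space \<alpha> \<beta> s N \<and>
      (\<forall>(i, j) \<in> X. eval2 p (real i) (real j) = a i j)"
    using unique by blast
  then show ?thesis
    using unique lift2_newton[of g f t N]
    unfolding N_def[symmetric] X_def[symmetric] f_def[symmetric] t_def[symmetric]
      g_def[symmetric] q0_def[symmetric] mn by auto
qed

end
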